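(* Let $a$ be a positive integer, $n=a^2+1$, and let $A\subseteq\mathbb{Z}_n$ be an $a$-subset with $A=-A$ that is a union of sets $P_x$, where $0\notin A$ if $a$ is even, and $0\in A$, $(a^2+1)/2\notin A$ if $a$ is odd. Let $U=(u[P_y])$ be a $(0,1)$-valued vector indexed by $\mathcal{P}\setminus\mathcal{P}(A)$ and let $J$ be the all-ones vector indexed by $\mathcal{P}$. Then $U$ is a solution of the matrix equation $M_AU^T=J^T$ if and only if \[B=\bigcup\{P_y\in\mathcal{P}\setminus\mathcal{P}(A): u[P_y]=1\}\] is a mate to $A$.
   Context: For $x\in\mathbb{Z}_n$, $P_x=\{x,-x\}$ (sets $P_x$ are considered as sets, so $P_x=P_{-x}$). If $a$ is even, $\mathcal{P}=\{P_x: 1\le x\le a^2/2\}$; if $a$ is odd, $\mathcal{P}=\{P_x:1\le x\le (a^2+1)/2\}$. $\mathcal{P}(A)=\{P_x: P_x\subseteq A\}$. For subsets $S,T$ of $\mathbb{Z}_n$, $\mathcal{D}(T,S)$ is the multiset $\{t-s: t\in T, s\in S\}$. For $P_y\in\mathcal{P}\setminus\mathcal{P}(A)$ and $P_d\in\mathcal{P}$, $M_A[P_d,P_y]$ is the number of distinct sets $P_x$ with $P_x\subseteq A$ and $P_d\subseteq\mathcal{D}(P_y,P_x)$; this defines the $|\mathcal{P}|\times|\mathcal{P}\setminus\mathcal{P}(A)|$ matrix $M_A$. An $a$-subset $A$ of $\mathbb{Z}_n$ has a mate $B$ if $B$ is an $a$-subset of $\mathbb{Z}_n$ such that the multiset $\mathcal{D}(B,A)$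 equals $\mathbb{Z}_n\setminus\{0\}$ (each nonzero element exactly once). *)

theory Defs
  imports "HOL-Number_Theory.Residues" "HOL-Library.Multiset"
begin

text \<open>\<open>\<int>\<^sub>n\<close> is the library ring \<^const>\<open>residue_ring\<close>, with carrier \<open>{0..n-1}\<close> inside \<^typ>\<open>int\<close>.\<close>

abbreviation Zn :: "nat \<Rightarrow> int set"
  where "Zn n \<equiv> carrier (residue_ring (int n))"

definition P :: "nat \<Rightarrow> int \<Rightarrow> int set"
  where "P n x = {x, \<ominus>\<^bsub>residue_ring (int n)\<^esub> x}"

text \<open>Neither case contains \<open>P\<^sub>0\<close>; for odd \<open>a\<close> the last member is the singleton \<open>P\<^bsub>n/2\<^esub>\<close>.
  Both divisions by 2 are exact.\<close>

definition all_pairs :: "nat \<Rightarrow> int set set"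
  where "all_pairs a =
    (if even a then {P (a\<^sup>2 + 1) x | x. 1 \<le> x \<and> x \<le> int (a\<^sup>2 div 2)}
     else {P (a\<^sup>2 + 1) x | x. 1 \<le> x \<and> x \<le> int ((a\<^sup>2 + 1) div 2)})"

text \<open>Here \<open>x\<close> ranges over all of \<open>\<int>\<^sub>n\<close>, so \<open>P\<^sub>0 = {0}\<close> is included when \<open>0 \<in> A\<close>.\<close>

definition pairs_in :: "nat \<Rightarrow> int set \<Rightarrow> int set set"
  where "pairs_in n A = {P n x | x. x \<in> Zn n \<and> P n x \<subseteq> A}"

definition diffs :: "nat \<Rightarrow> int set \<Rightarrow> int set \<Rightarrow> int multiset"
  where "diffs n T S =
    image_mset (\<lambda>(t, s). t \<ominus>\<^bsub>residue_ring (int n)\<^esub> s) (mset_set (T \<times> S))"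

text \<open>Rows and columns are indexed by the sets \<open>P\<^sub>d\<close>, \<open>P\<^sub>y\<close> themselves.\<close>

definition M :: "nat \<Rightarrow> int set \<Rightarrow> int set \<Rightarrow> int set \<Rightarrow> nat"
  where "M n A Pd Py = card {Px \<in> pairs_in n A. Pd \<subseteq> set_mset (diffs n Py Px)}"

definition is_mate :: "nat \<Rightarrow> int set \<Rightarrow> int set \<Rightarrow> bool"
  where "is_mate a A B \<longleftrightarrow>
    B \<subseteq> Zn (a\<^sup>2 + 1) \<and> card B = a \<and>
    diffs (a\<^sup>2 + 1) B A = mset_set (Zn (a\<^sup>2 + 1) - {0})"

end

theory Submission
  imports Defs
begin

text \<open>Count the representations of \<open>d\<close> as \<open>b - s\<close> with \<open>b \<in> B\<close> and \<open>s \<in> A\<close>. The row of \<open>M\<^sub>A U\<close>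
  indexed by \<open>P\<^sub>d\<close> counts the blocks \<open>P\<^sub>b \<times> P\<^sub>s\<close> that contain such a representation. A block contains
  at most one of them, except that for \<open>2 d = 0\<close> it may also contain the negated one \<open>(-b, -s)\<close>.
  So if all row sums are 1, every \<open>d \<noteq> 0\<close> is represented exactly once, apart possibly from
  \<open>d = n/2\<close>, which could be represented twice. In that case \<open>a |B| = a\<^sup>2 + 1\<close>, so \<open>a = 1\<close> and
  \<open>|B| = 2\<close>, contradicting \<open>B \<subseteq> \<int>\<^sub>2 \ {0}\<close>.\<close>

section \<open>Residue arithmetic and the pairs \<open>P n x\<close>\<close>

lemma Zn_eq: "Zn n = {0..<int n}"
  by (auto simp: residue_ring_def)

lemma neg_residue_ring:
  assumes "n > 1"
  shows "\<ominus>\<^bsub>residue_ring (int n)\<^esub> x = (- x) mod int n"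
proof -
  interpret residues "int n" "residue_ring (int n)"
    using assms by unfold_locales auto
  show ?thesis by (rule res_neg_eq)
qed

lemma minus_residue_ring:
  assumes "n > 1"
  shows "x \<ominus>\<^bsub>residue_ring (int n)\<^esub> y = (x - y) mod int n"
  unfolding a_minus_def neg_residue_ring[OF assms]
  by (simp add: residue_ring_def mod_simps)

lemma P_eq: "n > 1 \<Longrightarrow> P n x = {x, (- x) mod int n}"
  by (simp add: P_def neg_residue_ring)

text \<open>\<open>P n x\<close> contains \<open>x\<close> itself, unreduced, so negating twice
  returns to \<open>x\<close> only when \<open>x\<close> is a reduced representative.\<close>

lemma P_eq_if_mem:
  assumes "n > 1" "x \<in> {0..<int n}" "y \<in> P n x"
  shows "P n y = P n x"
  using assms by (auto simp: P_eq mod_simps)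

lemma P_uminus_mod:
  assumes "n > 1" "x \<in> {0..<int n}"
  shows "P n ((- x) mod int n) = P n x"
  by (rule P_eq_if_mem[OF assms]) (simp add: P_eq[OF assms(1)])

text \<open>Going up to half of \<open>n\<close> already lists every nonzero pair, since
  \<open>x\<close> and \<open>n - x\<close> give the same one. This removes the split by the parity
  of \<open>a\<close>.\<close>

lemma all_pairs_eq:
  assumes "a > 0"
  shows "all_pairs a = P (a\<^sup>2 + 1) ` {1..int (a\<^sup>2)}"
proof -
  define n where "n = a\<^sup>2 + 1"
  define h where "h = (if even a then a\<^sup>2 div 2 else (a\<^sup>2 + 1) div 2)"
  have n: "n > 1" using assms by (simp add: n_def)
  \<comment> \<open>The second bound gives \<open>n - x \<le> h\<close> whenever
    \<open>x > h\<close>, so reflection lands in the listed half.\<close>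
  have h: "h \<le> a\<^sup>2" "n \<le> 2 * h + 1"
    using n unfolding h_def n_def by (auto, presburger)
  have "all_pairs a = P n ` {1..int h}"
    by (auto simp: all_pairs_def h_def n_def)
  also have "\<dots> = P n ` {1..int (a\<^sup>2)}"
  proof
    show "P n ` {1..int h} \<subseteq> P n ` {1..int (a\<^sup>2)}"
      using h by (intro image_mono) auto
    show "P n ` {1..int (a\<^sup>2)} \<subseteq> P n ` {1..int h}"
    proof
      fix p assume "p \<in> P n ` {1..int (a\<^sup>2)}"
      then obtain x where x: "p = P n x" "1 \<le> x" "x < int n"
        by (auto simp: n_def)
      show "p \<in> P n ` {1..int h}"
      proof (cases "x \<le> int h")
        case False
        have "(- x) mod int n = int n - x"
          using x n by (simp add: zmod_zminus1_eq_if)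
        then have "p = P n (int n - x)"
          using P_uminus_mod[of n x] n x by simp
        then show ?thesis using False x h by auto
      qed (use x in auto)
    qed
  qed
  finally show ?thesis by (simp add: n_def)
qed

section \<open>Multiplicities of differences\<close>

lemma count_diffs:
  assumes "n > 1" "finite T" "finite S"
  shows "count (diffs n T S) d = card {(t, s) \<in> T \<times> S. (t - s) mod int n = d}"
proof -
  have "count (diffs n T S) d = card ({p. (\<lambda>(t, s). (t - s) mod int n) p = d} \<inter> (T \<times> S))"
    unfolding diffs_def minus_residue_ring[OF assms(1)]
    using assms by (subst count_image_mset') (auto simp: Int_def intro!: arg_cong[where f = card])
  also have "{p. (\<lambda>(t, s). (t - s) mod int n) p = d} \<inter> (T \<times> S)
      = {(t, s) \<in> T \<times> S. (t - s) mod int n = d}"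
    by auto
  finally show ?thesis .
qed

lemma set_diffs:
  assumes "n > 1" "finite T" "finite S"
  shows "set_mset (diffs n T S) = {(t - s) mod int n | t s. t \<in> T \<and> s \<in> S}"
  using assms by (auto simp: diffs_def minus_residue_ring)

definition reps :: "nat \<Rightarrow> int set \<Rightarrow> int set \<Rightarrow> int \<Rightarrow> (int \<times> int) set"
  where "reps n B A d = {(b, s) \<in> B \<times> A. (b - s) mod int n = d}"

section \<open>The set \<open>E\<close> of selected pairs and its union \<open>B\<close>\<close>

locale pair_blocks =
  fixes n :: nat and A :: "int set" and E :: "int set set"
  assumes n: "n > 1"
    and A: "A \<subseteq> {0..<int n}"
    and A_sym: "x \<in> A \<Longrightarrow> (- x) mod int n \<in> A"
    and E: "E \<subseteq> P n ` {1..<int n} - pairs_in n A"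
begin

abbreviation "B \<equiv> \<Union>E"

lemma P_subset_A: "x \<in> A \<Longrightarrow> P n x \<subseteq> A"
  using A_sym n by (auto simp: P_eq)

lemma E_cases:
  assumes "p \<in> E"
  obtains y where "p = P n y" "1 \<le> y" "y < int n"
  using assms E by fastforce

lemma P_eq_if_mem_E:
  assumes "p \<in> E" "b \<in> p"
  shows "P n b = p"
proof -
  obtain y where "p = P n y" "1 \<le> y" "y < int n" using assms(1) by (rule E_cases)
  then show ?thesis using P_eq_if_mem[of n y b] n assms by auto
qed

lemma B_subset: "B \<subseteq> {1..<int n}"
proof
  fix b assume "b \<in> B"
  then obtain y where y: "b \<in> P n y" "1 \<le> y" "y < int n" by (metis UnionE E_cases)
  \<comment> \<open>Since \<open>y\<close> is nonzero, its negative reduces to \<open>n - y\<close>;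
    hence 0 never enters \<open>B\<close>.\<close>
  then have "b = y \<or> b = int n - y" using n by (auto simp: P_eq zmod_zminus1_eq_if)
  then show "b \<in> {1..<int n}" using y by auto
qed

lemma finite_A: "finite A" using A finite_subset by blast

lemma finite_B: "finite B" using B_subset finite_subset by blast

lemma finite_reps: "finite (reps n B A d)"
  by (rule finite_subset[of _ "B \<times> A"])
    (auto simp: reps_def finite_A finite_B simp del: Union_iff)

lemma finite_E: "finite E"
  using E by (rule finite_subset) auto

text \<open>By symmetry, an element of \<open>A\<close> has its whole pair inside \<open>A\<close>,
  and such pairs are excluded from \<open>E\<close>.\<close>

lemma disjoint: "B \<inter> A = {}"
proof (rule ccontr)
  assume "B \<inter> A \<noteq> {}"
  then obtain b p where b: "b \<in> A" "p \<in> E" "b \<in> p" by blast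
  then have "p = P n b" using P_eq_if_mem_E by blast
  then have "p \<in> pairs_in n A"
    using b A P_subset_A unfolding pairs_in_def Zn_eq by blast
  then show False using b E by blast
qed

lemma reps_0: "reps n B A 0 = {}"
proof (rule equals0I)
  fix z assume "z \<in> reps n B A 0"
  then obtain b s where bs: "b \<in> B" "s \<in> A" "int n dvd b - s"
    by (auto simp: reps_def)
  then have "b mod int n = s mod int n" by (simp add: mod_eq_dvd_iff)
  moreover have "b \<in> {1..<int n}" "s \<in> {0..<int n}" using bs A B_subset by blast+
  ultimately have "b = s" by simp
  then show False using bs disjoint by blast
qed

text \<open>\<open>b\<close> and \<open>d\<close> fix \<open>s\<close> modulo \<open>n\<close>, and
  \<open>A\<close> holds only reduced representatives.\<close>

lemma snd_reps_unique:
  assumes "(b, s) \<in> reps n B A d" "(b, s') \<in> reps n B A d"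
  shows "s = s'"
proof -
  have "(b - s) mod int n = (b - s') mod int n" using assms by (auto simp: reps_def)
  then have "int n dvd s' - s" by (simp add: mod_eq_dvd_iff)
  then have "s' mod int n = s mod int n" by (simp add: mod_eq_dvd_iff)
  moreover have "s \<in> {0..<int n}" "s' \<in> {0..<int n}" using assms A by (auto simp: reps_def)
  ultimately show ?thesis by simp
qed

section \<open>Row sums as numbers of blocks\<close>

lemma finite_pairs_in: "finite (pairs_in n A)"
proof -
  have "pairs_in n A \<subseteq> P n ` {0..<int n}" unfolding pairs_in_def Zn_eq by blast
  then show ?thesis by (rule finite_subset) simp
qed

lemma row_sum_eq_card_blocks:
  assumes d: "d \<in> {0..<int n}"
  shows "(\<Sum>p\<in>E. M n A (P n d) p) = card ((\<lambda>(b, s). (P n b, P n s)) ` reps n B A d)"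
proof -
  let ?X = "\<lambda>p. {q \<in> pairs_in n A. P n d \<subseteq> set_mset (diffs n p q)}"
  have fin_P: "finite (P n x)" for x using n by (simp add: P_eq)
  have "(\<Sum>p\<in>E. M n A (P n d) p) = card (SIGMA p:E. ?X p)"
    by (simp add: M_def card_SigmaI finite_E finite_pairs_in)
  also have "(SIGMA p:E. ?X p) = (\<lambda>(b, s). (P n b, P n s)) ` reps n B A d"
  proof (intro equalityI subsetI)
    fix z assume "z \<in> (SIGMA p:E. ?X p)"
    then obtain p q where z: "z = (p, q)" "p \<in> E" "q \<in> pairs_in n A"
      "P n d \<subseteq> set_mset (diffs n p q)" by auto
    obtain y where y: "p = P n y" using z(2) by (rule E_cases)
    obtain x where x: "q = P n x" "x \<in> {0..<int n}" "P n x \<subseteq> A"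
      using z(3) unfolding pairs_in_def Zn_eq by auto
    have "d \<in> set_mset (diffs n p q)" using z(4) n by (auto simp: P_eq)
    then obtain t s where ts: "t \<in> p" "s \<in> q" "d = (t - s) mod int n"
      using set_diffs[OF n, of p q] y x fin_P by auto
    have "P n t = p" using P_eq_if_mem_E z(2) ts(1) by blast
    moreover have "P n s = q" using P_eq_if_mem[OF n x(2)] ts(2) x(1) by simp
    moreover have "(t, s) \<in> reps n B A d" using ts z(2) x by (auto simp: reps_def)
    ultimately show "z \<in> (\<lambda>(b, s). (P n b, P n s)) ` reps n B A d"
      using z(1) by force
  next
    fix z assume "z \<in> (\<lambda>(b, s). (P n b, P n s)) ` reps n B A d"
    then obtain b s p where z: "z = (P n b, P n s)" "b \<in> p" "p \<in> E" "s \<in> A"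
      "d = (b - s) mod int n" by (auto simp: reps_def)
    have p: "P n b = p" using P_eq_if_mem_E z by blast
    have q: "P n s \<in> pairs_in n A"
      using z(4) A P_subset_A unfolding pairs_in_def Zn_eq by blast
    \<comment> \<open>The negated representation lies in the same block and gives \<open>-d\<close>,
      so a block containing \<open>d\<close> as a difference contains all of
      \<open>P n d\<close>.\<close>
    have "(- d) mod int n = ((- b) mod int n - (- s) mod int n) mod int n"
      by (simp add: z(5) mod_simps)
    then have "P n d \<subseteq> set_mset (diffs n (P n b) (P n s))"
      unfolding set_diffs[OF n fin_P fin_P] unfolding P_eq[OF n] using z(5) by blast
    then show "z \<in> (SIGMA p:E. ?X p)" using z p q by auto
  qed
  finally show ?thesis .
qed

text \<open>Two representations in one block differ only by signs. Changing the sign of one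
  coordinate alone cannot preserve the difference unless that coordinate stays the same; changing
  both turns \<open>d\<close> into \<open>-d\<close>, which the hypothesis rules out.\<close>

lemma blocks_inj_on:
  assumes "(2 * d) mod int n \<noteq> 0"
  shows "inj_on (\<lambda>(b, s). (P n b, P n s)) (reps n B A d)"
proof (rule inj_onI, clarify)
  fix b s b' s'
  assume bs: "(b, s) \<in> reps n B A d" and bs': "(b', s') \<in> reps n B A d"
    and eq: "P n b = P n b'" "P n s = P n s'"
  have b': "b' = b \<or> b' = (- b) mod int n" and s': "s' = s \<or> s' = (- s) mod int n"
    using eq n by (auto simp: P_eq)
  have diff: "(b - s) mod int n = d" "(b' - s') mod int n = d"
    using bs bs' by (auto simp: reps_def)
  have b_range: "b \<in> {0..<int n}" "b' \<in> {0..<int n}"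
    using bs bs' B_subset by (force simp: reps_def)+
  have "b' = b"
  proof (rule ccontr)
    assume "b' \<noteq> b"
    then have b'': "b' = (- b) mod int n" using b' by blast
    show False
    proof (cases "s' = s")
      case True
      then have "int n dvd b' - b" using diff mod_eq_dvd_iff[of "b' - s" "int n" "b - s"] by simp
      then have "b' mod int n = b mod int n" by (simp add: mod_eq_dvd_iff)
      then show False using b_range \<open>b' \<noteq> b\<close> by simp
    next
      \<comment> \<open>Here both coordinates are negated, so \<open>d\<close> equals its own
        negative.\<close>
      case False
      then have "d = (- b - - s) mod int n" using s' b'' diff(2) by (simp add: mod_simps)
      then have "(2 * d) mod int n = ((b - s) mod int n + (- b - - s) mod int n) mod int n"
        using diff(1) by simp
      also have "\<dots> = 0" by (simp add: mod_simps)
      finally show False using assms by blast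
    qed
  qed
  moreover from this have "s' = s" using snd_reps_unique bs bs' by blast
  ultimately show "b = b' \<and> s = s'" by simp
qed

text \<open>A single block confines \<open>b\<close> to one pair, hence to at most two values, and
  each \<open>b\<close> determines its \<open>s\<close>.\<close>

lemma card_reps_if_one_block:
  assumes "card ((\<lambda>(b, s). (P n b, P n s)) ` reps n B A d) = 1"
  shows "card (reps n B A d) \<in> {1, 2}"
proof -
  obtain z where z: "(\<lambda>(b, s). (P n b, P n s)) ` reps n B A d = {z}"
    using assms by (rule card_1_singletonE)
  then have "reps n B A d \<noteq> {}" by auto
  then obtain b s where bs: "(b, s) \<in> reps n B A d" by auto
  have "fst ` reps n B A d \<subseteq> P n b"
  proof clarsimp
    fix b' s' assume "(b', s') \<in> reps n B A d"
    then have "(P n b', P n s') = z" "(P n b, P n s) = z"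
      using z bs by (metis (no_types, lifting) case_prod_conv imageI singletonD)+
    then have "P n b' = P n b" by blast
    then show "b' \<in> P n b" by (auto simp: P_def)
  qed
  moreover have "finite (P n b)" "card (P n b) \<le> 2"
    using n by (auto simp: P_eq card_insert_if)
  ultimately have "card (fst ` reps n B A d) \<le> 2"
    using card_mono order_trans by blast
  moreover have "inj_on fst (reps n B A d)"
    using snd_reps_unique by (auto intro!: inj_onI)
  ultimately have "card (reps n B A d) \<le> 2" by (simp add: card_image)
  moreover have "card (reps n B A d) \<noteq> 0" using bs finite_reps by auto
  ultimately show ?thesis by auto
qed

section \<open>Double counting and the mate condition\<close>

lemma sum_card_reps: "(\<Sum>d\<in>{1..<int n}. card (reps n B A d)) = card B * card A"
proof -
  \<comment> \<open>The difference 0 does not occur, so it may be added; the classes of all residues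
    then partition \<open>B \<times> A\<close>.\<close>
  have "(\<Sum>d\<in>{1..<int n}. card (reps n B A d)) = (\<Sum>d\<in>{0..<int n}. card (reps n B A d))"
  proof (rule sum.mono_neutral_left)
    have "{0..<int n} - {1..<int n} = {0}" using n by auto
    then show "\<forall>d\<in>{0..<int n} - {1..<int n}. card (reps n B A d) = 0" by (simp add: reps_0)
  qed auto
  also have "\<dots> = card (\<Union>d\<in>{0..<int n}. reps n B A d)"
    by (rule card_UN_disjoint[symmetric]) (auto simp: finite_reps, auto simp: reps_def)
  also have "(\<Union>d\<in>{0..<int n}. reps n B A d) = B \<times> A"
    using n by (auto simp: reps_def)
  finally show ?thesis by (simp add: card_cartesian_product)
qed

lemma is_mate_iff:
  assumes "n = a\<^sup>2 + 1" "card A = a"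
  shows "is_mate a A B \<longleftrightarrow> (\<forall>d\<in>{1..<int n}. card (reps n B A d) = 1)" (is "_ \<longleftrightarrow> ?R")
proof
  have cnt: "count (diffs n B A) d = card (reps n B A d)" for d
    unfolding reps_def by (rule count_diffs[OF n finite_B finite_A])
  have Zn: "Zn n - {0} = {1..<int n}" unfolding Zn_eq by auto
  {
    assume "is_mate a A B"
    then have "diffs n B A = mset_set {1..<int n}"
      using Zn by (simp add: is_mate_def assms)
    then show ?R using cnt by (metis count_mset_set(1) finite_atLeastLessThan_int)
  next
    assume R: ?R
    have a: "a > 0" using n assms by (cases a) auto
    \<comment> \<open>The size of \<open>B\<close> is forced: there are \<open>a * a\<close> nonzero
      residues, each represented once.\<close>
    have "card B * a = (\<Sum>d\<in>{1..<int n}. card (reps n B A d))"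
      using sum_card_reps assms by simp
    also have "\<dots> = a * a" using R assms(1) by (simp add: power2_eq_square nat_mult_distrib)
    finally have card_B: "card B = a" using a by simp
    have "diffs n B A = mset_set {1..<int n}"
    proof (rule multiset_eqI)
      fix d
      \<comment> \<open>Outside the range both counts vanish: 0 is excluded by disjointness, and any
        other such integer is not a reduced residue.\<close>
      have "reps n B A d = {}" if "d \<notin> {1..<int n}"
      proof (cases "d = 0")
        case False
        then have "d \<notin> {0..<int n}" using that by auto
        then show ?thesis using n by (auto simp: reps_def)
      qed (simp add: reps_0)
      then show "count (diffs n B A) d = count (mset_set {1..<int n}) d"
        using R cnt by (cases "d \<in> {1..<int n}") auto
    qed
    moreover have "B \<subseteq> Zn n" using B_subset unfolding Zn_eq by auto
    ultimately show "is_mate a A B"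
      using Zn card_B by (simp add: is_mate_def assms)
  }
qed

lemma card_reps_eq_1:
  assumes "n = a\<^sup>2 + 1" "card A = a"
    and blocks: "\<And>d. d \<in> {1..<int n} \<Longrightarrow>
      card ((\<lambda>(b, s). (P n b, P n s)) ` reps n B A d) = 1"
    and e: "e \<in> {1..<int n}"
  shows "card (reps n B A e) = 1"
proof (rule ccontr)
  assume neq: "card (reps n B A e) \<noteq> 1"
  then have two: "card (reps n B A e) = 2" using card_reps_if_one_block blocks[OF e] by blast
  \<comment> \<open>An exceptional \<open>d\<close> violates injectivity on blocks, so
    \<open>n\<close> divides \<open>2 * d\<close>; as \<open>0 < 2 * d < 2 * n\<close>, the quotient
    is 1. Hence there is at most one exceptional \<open>d\<close>.\<close>
  have half: "2 * d = int n" if "d \<in> {1..<int n}" "card (reps n B A d) \<noteq> 1" for d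
  proof -
    have "(2 * d) mod int n = 0"
      using blocks_inj_on[of d] blocks[OF that(1)] that(2) card_image by metis
    then obtain k where k: "2 * d = int n * k" by (auto simp: mod_eq_0_iff_dvd)
    then have "0 < int n * k" "int n * k < int n * 2" using that(1) by (simp_all flip: k)
    then have "k = 1" using n by (simp add: zero_less_mult_iff mult_less_cancel_left)
    then show ?thesis using k by simp
  qed
  have "card (reps n B A d) = 1" if "d \<in> {1..<int n} - {e}" for d
    using half[of d] half[OF e neq] that by auto
  \<comment> \<open>The \<open>n - 2\<close> nonzero residues other than \<open>e\<close> contribute
    1 each; with the 2 from \<open>e\<close> the total is \<open>n\<close>, one more than
    \<open>a * a\<close>.\<close>
  then have "(\<Sum>d\<in>{1..<int n} - {e}. card (reps n B A d)) = n - 2"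
    using e by (simp add: card_Diff_singleton)
  then have "card B * a = n"
    using sum_card_reps sum.remove[OF _ e, of "\<lambda>d. card (reps n B A d)"] two n assms by simp
  then have eq: "card B * a = a * a + 1" using assms by (simp add: power2_eq_square)
  then have "a dvd a * a + 1" by (metis dvd_triv_right)
  then have "a dvd 1" using dvd_add_right_iff[of a "a * a" 1] by simp
  then have "a = 1" by simp
  then have "card B = 2" "n = 2" using eq assms by auto
  then show False using card_mono[OF _ B_subset] by simp
qed

lemma row_sums_eq_1_iff:
  assumes "n = a\<^sup>2 + 1" "card A = a"
  shows "(\<forall>d\<in>{1..<int n}. (\<Sum>p\<in>E. M n A (P n d) p) = 1) \<longleftrightarrow> is_mate a A B"
proof -
  \<comment> \<open>One representation yields one block at once; the converse needs the condition
    for all \<open>d\<close> together, through \<open>card_reps_eq_1\<close>.\<close>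
  have "(\<forall>d\<in>{1..<int n}. card ((\<lambda>(b, s). (P n b, P n s)) ` reps n B A d) = 1) \<longleftrightarrow>
      (\<forall>d\<in>{1..<int n}. card (reps n B A d) = 1)"
    using card_reps_eq_1[OF assms] by (auto simp: card_1_singleton_iff)
  then show ?thesis
    unfolding is_mate_iff[OF assms] by (simp add: row_sum_eq_card_blocks)
qed

end

section \<open>From the matrix equation to row sums over \<open>E\<close>\<close>

theorem theorem3p14:
  fixes a n :: nat and A :: "int set" and u :: "int set \<Rightarrow> int"
  assumes "a > 0"
    and "n = a\<^sup>2 + 1"
    and "A \<subseteq> Zn n" and "card A = a"
    and "A = (\<lambda>x. \<ominus>\<^bsub>residue_ring (int n)\<^esub> x) ` A"
    and "\<exists>X \<subseteq> Zn n. A = (\<Union>x\<in>X. P n x)"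
    and "even a \<Longrightarrow> 0 \<notin> A"
    and "odd a \<Longrightarrow> 0 \<in> A \<and> int ((a\<^sup>2 + 1) div 2) \<notin> A"
    and "\<forall>Py \<in> all_pairs a - pairs_in n A. u Py \<in> {0, 1}"
  shows "(\<forall>Pd \<in> all_pairs a.
            (\<Sum>Py \<in> all_pairs a - pairs_in n A. int (M n A Pd Py) * u Py) = 1)
         \<longleftrightarrow> is_mate a A (\<Union>{Py \<in> all_pairs a - pairs_in n A. u Py = 1})"
proof -
  define C where "C = all_pairs a - pairs_in n A"
  define E where "E = {p \<in> C. u p = 1}"
  have n: "n > 1" using assms by simp
  have "{1..int (a\<^sup>2)} = {1..<int n}" using assms(2) by auto
  then have pairs: "all_pairs a = P n ` {1..<int n}"
    using all_pairs_eq[OF assms(1)] assms(2) by simp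
  then have finite_C: "finite C" by (simp add: C_def)
  interpret pair_blocks n A E
  proof
    show "(- x) mod int n \<in> A" if "x \<in> A" for x
      using that assms(5) neg_residue_ring[OF n] by (metis imageI)
  qed (use n assms(3) in \<open>auto simp: Zn_eq E_def C_def pairs\<close>)
  have "(\<Sum>p\<in>C. int (M n A q p) * u p) = int (\<Sum>p\<in>E. M n A q p)" for q
  proof -
    \<comment> \<open>As \<open>u\<close> takes only the values 0 and 1 on \<open>C\<close>,
      weighting by \<open>u\<close> restricts the sum to \<open>E\<close>.\<close>
    have "(\<Sum>p\<in>C. int (M n A q p) * u p) = (\<Sum>p\<in>C. if u p = 1 then int (M n A q p) else 0)"
      using assms(9) by (intro sum.cong) (auto simp: C_def)
    also have "\<dots> = (\<Sum>p\<in>E. int (M n A q p))"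
      unfolding E_def by (simp add: sum.inter_filter finite_C)
    finally show ?thesis by simp
  qed
  then have "(\<forall>q\<in>all_pairs a. (\<Sum>p\<in>C. int (M n A q p) * u p) = 1) \<longleftrightarrow>
      (\<forall>d\<in>{1..<int n}. (\<Sum>p\<in>E. M n A (P n d) p) = 1)"
    unfolding pairs by (simp flip: of_nat_sum)
  also have "\<dots> \<longleftrightarrow> is_mate a A (\<Union>E)"
    by (rule row_sums_eq_1_iff[OF assms(2,4)])
  finally show ?thesis unfolding E_def C_def .
qed

end
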